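(* For any digraph $D$, $\Xi_D(1^i;1^j)=C(D;i,j)$.
   Context: A digraph is a finite labelled directed graph without multiple edges, possibly with loops and with bidirected edges. A path-cycle cover of $D$ is a subset $S$ of the edges of $D$ no two of which share their initial vertex and no two of which share their terminal vertex; equivalently the spanning subgraph with edge set $S$ is a vertex-disjoint union of directed paths and directed cycles (isolated vertices are directed paths with no edges; loops are cycles of length one). $\pi(S)$ and $\sigma(S)$ are the sets of vertex sets of the paths and cycles respectively, and $\ell$ denotes the number of blocks. With $i^{\underline k}=i(i-1)\cdots(i-k+1)$, the cover polynomial is $C(D;i,j)=\sum_S i^{\underline{\ell(\pi(S))}}j^{\ell(\sigma(S))}$, the sum over all path-cycle covers $S$ of $D$. With $x,y$ two countably infinite sets of commuting indeterminates, $\tilde m_\lambda=(r_1!r_2!\cdots)m_\lambda$ ($r_i$ the number of parts of $\lambda$ equal to $i$), $p_\lambda$ the power sums, and set partitions in subscripts standing for the integer partition of their block sizes, the path-cycle symmetric function is $\Xi_D(x;y)=\sum_S\tilde m_{\pi(S)}(x)\,p_{\sigma(S)}(y)$, the sum over all path-cycle covers $S$ of $D$. $g(1^i;1^j)$ denotes the polynomial in $i,j$ obtained from $g(x;y)$ by setting $i$ of the $x$ variables and $j$ of the $y$ variables equal to $1$ and all others equal to $0$. *)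

theory Defs
  imports
    "Graph_Theory.Pair_Digraph"
    "HOL-Library.Multiset"
    "HOL-Library.Groups_Big_Fun"
    "HOL-Computational_Algebra.Polynomial"
begin

section \<open>Formal power series in arbitrarily many commuting indeterminates\<close>

text \<open>
  A monomial in indeterminates of type \<open>'v\<close> is a finite multiset over \<open>'v\<close> (multiplicities are
  the exponents, multiset sum is multiplication of monomials); a formal power series assigns a
  coefficient to every monomial.
\<close>

typedef (overloaded) ('v, 'a) mfps = "UNIV :: ('v multiset \<Rightarrow> 'a) set"
  morphisms mfps_coeff Abs_mfps
  by simp

setup_lifting type_definition_mfps

lemma mfps_eqI: "(\<And>M. mfps_coeff f M = mfps_coeff g M) \<Longrightarrow> f = g"
  by transfer auto

lemma finite_submultisets: "finite {A. A \<subseteq># (M :: 'v multiset)}"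
proof (rule finite_surj)
  show "finite {xs. set xs \<subseteq> set_mset M \<and> length xs \<le> size M}"
    by (rule finite_lists_length_le) simp
  show "{A. A \<subseteq># M} \<subseteq> mset ` {xs. set xs \<subseteq> set_mset M \<and> length xs \<le> size M}"
  proof
    fix A assume "A \<in> {A. A \<subseteq># M}"
    moreover obtain xs where "mset xs = A" using ex_mset by blast
    ultimately show "A \<in> mset ` {xs. set xs \<subseteq> set_mset M \<and> length xs \<le> size M}"
      using set_mset_mono[of A M] size_mset_mono[of A M] by force
  qed
qed

lemma finite_mset_splits: "finite {(A, B). A + B = (M :: 'v multiset)}"
proof (rule finite_subset)
  show "{(A, B). A + B = M} \<subseteq> {A. A \<subseteq># M} \<times> {A. A \<subseteq># M}" by auto
qed (simp add: finite_submultisets)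

lemma finite_mset_splits': "finite {p. fst p + snd p = (M :: 'v multiset)}"
  using finite_mset_splits[of M] by (simp add: case_prod_unfold)

instantiation mfps :: (type, comm_ring_1) comm_ring_1
begin

lift_definition zero_mfps :: "('a, 'b) mfps" is "\<lambda>_. 0" .
lift_definition one_mfps :: "('a, 'b) mfps" is "\<lambda>M. if M = {#} then 1 else 0" .
lift_definition plus_mfps :: "('a, 'b) mfps \<Rightarrow> ('a, 'b) mfps \<Rightarrow> ('a, 'b) mfps"
  is "\<lambda>f g M. f M + g M" .
lift_definition minus_mfps :: "('a, 'b) mfps \<Rightarrow> ('a, 'b) mfps \<Rightarrow> ('a, 'b) mfps"
  is "\<lambda>f g M. f M - g M" .
lift_definition uminus_mfps :: "('a, 'b) mfps \<Rightarrow> ('a, 'b) mfps"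
  is "\<lambda>f M. - f M" .
lift_definition times_mfps :: "('a, 'b) mfps \<Rightarrow> ('a, 'b) mfps \<Rightarrow> ('a, 'b) mfps"
  is "\<lambda>f g M. \<Sum>(A, B) \<in> {(A, B). A + B = M}. f A * g B" .

instance
proof
  fix f g h :: "('a, 'b) mfps"
  show "f * g * h = f * (g * h)"
  proof (transfer, rule ext)
    fix f g h :: "'a multiset \<Rightarrow> 'b" and M :: "'a multiset"
    have "(\<Sum>(X, C) \<in> {(X, C). X + C = M}. (\<Sum>(A, B) \<in> {(A, B). A + B = X}. f A * g B) * h C) =
      (\<Sum>p \<in> {(X, C). X + C = M}. \<Sum>q \<in> {(A, B). A + B = fst p}. f (fst q) * g (snd q) * h (snd p))"
      by (simp add: sum_distrib_right case_prod_unfold)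
    also have "\<dots> = (\<Sum>z \<in> Sigma {(X, C). X + C = M} (\<lambda>p. {(A, B). A + B = fst p}).
        f (fst (snd z)) * g (snd (snd z)) * h (snd (fst z)))"
      by (subst sum.Sigma) (auto simp: finite_mset_splits' case_prod_unfold)
    also have "\<dots> = (\<Sum>z \<in> Sigma {(A, Y). A + Y = M} (\<lambda>p. {(B, C). B + C = snd p}).
        f (fst (fst z)) * (g (fst (snd z)) * h (snd (snd z))))"
      by (rule sum.reindex_bij_witness[where
            i = "\<lambda>((A, Y), (B, C)). ((A + B, C), (A, B))" and
            j = "\<lambda>((X, C), (A, B)). ((A, B + C), (B, C))"])
         (auto simp: algebra_simps)
    also have "\<dots> = (\<Sum>p \<in> {(A, Y). A + Y = M}. \<Sum>q \<in> {(B, C). B + C = snd p}.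
        f (fst p) * (g (fst q) * h (snd q)))"
      by (subst sum.Sigma) (auto simp: finite_mset_splits' case_prod_unfold)
    also have "\<dots> = (\<Sum>(A, Y) \<in> {(A, Y). A + Y = M}. f A * (\<Sum>(B, C) \<in> {(B, C). B + C = Y}. g B * h C))"
      by (simp add: sum_distrib_left case_prod_unfold)
    finally show "(\<Sum>(X, C) \<in> {(X, C). X + C = M}. (\<Sum>(A, B) \<in> {(A, B). A + B = X}. f A * g B) * h C) =
      (\<Sum>(A, Y) \<in> {(A, Y). A + Y = M}. f A * (\<Sum>(B, C) \<in> {(B, C). B + C = Y}. g B * h C))" .
  qed
  show "f * g = g * f"
  proof (transfer, rule ext)
    fix f g :: "'a multiset \<Rightarrow> 'b" and M :: "'a multiset"
    show "(\<Sum>(A, B) \<in> {(A, B). A + B = M}. f A * g B) = (\<Sum>(A, B) \<in> {(A, B). A + B = M}. g A * f B)"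
      by (rule sum.reindex_bij_witness[where i = prod.swap and j = prod.swap])
         (auto simp: algebra_simps)
  qed
  show "1 * f = f"
  proof (transfer, rule ext)
    fix f :: "'a multiset \<Rightarrow> 'b" and M :: "'a multiset"
    have "(\<Sum>(A, B) \<in> {(A, B). A + B = M}. (if A = {#} then 1 else 0) * f B) =
      (\<Sum>(A, B) \<in> {({#} :: 'a multiset, M)}. (if A = {#} then 1 else 0) * f B)"
      by (rule sum.mono_neutral_right) (auto simp: finite_mset_splits split: if_splits)
    then show "(\<Sum>(A, B) \<in> {(A, B). A + B = M}. (if A = {#} then 1 else 0) * f B) = f M"
      by simp
  qed
  show "(f + g) * h = f * h + g * h"
    by transfer (auto simp: distrib_right sum.distrib case_prod_unfold)
  show "f + g + h = f + (g + h)" by transfer (auto simp: algebra_simps)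
  show "f + g = g + f" by transfer (auto simp: algebra_simps)
  show "0 + f = f" by transfer auto
  show "- f + f = 0" by transfer auto
  show "f - g = f + - g" by transfer auto
  show "(0 :: ('a, 'b) mfps) \<noteq> 1" by transfer (metis zero_neq_one)
qed

end

text \<open>
  Substitution of scalars for the indeterminates. \<^const>\<open>Sum_any\<close> sums over all monomials; this is
  the intended value if only finitely many terms are nonzero, which is the case for power series of
  bounded degree when only finitely many indeterminates receive a nonzero value.
\<close>

definition mfps_eval :: "('v \<Rightarrow> 'a) \<Rightarrow> ('v, 'a :: comm_ring_1) mfps \<Rightarrow> 'a" where
  "mfps_eval \<rho> f = Sum_any (\<lambda>M. mfps_coeff f M * (\<Prod>v\<in>#M. \<rho> v))"


section \<open>Symmetric functions in two alphabets\<close>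

datatype indet = XVar nat | YVar nat

text \<open>Integer partitions are represented by the finite multisets of their (positive) parts.\<close>

definition msym_x :: "nat multiset \<Rightarrow> (indet, rat) mfps" where
  "msym_x \<mu> = Abs_mfps (\<lambda>M.
     if set_mset M \<subseteq> range XVar \<and> image_mset (count M) (mset_set (set_mset M)) = \<mu> then 1 else 0)"

definition aug_msym_x :: "nat multiset \<Rightarrow> (indet, rat) mfps" where
  "aug_msym_x \<mu> = of_nat (\<Prod>k\<in>set_mset \<mu>. fact (count \<mu> k)) * msym_x \<mu>"

definition psum_y :: "nat \<Rightarrow> (indet, rat) mfps" where
  "psum_y n = Abs_mfps (\<lambda>M. if \<exists>k. M = replicate_mset n (YVar k) then 1 else 0)"

definition power_sum_y :: "nat multiset \<Rightarrow> (indet, rat) mfps" where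
  "power_sum_y \<mu> = (\<Prod>n\<in>#\<mu>. psum_y n)"

definition set_ones :: "nat set \<Rightarrow> nat set \<Rightarrow> (indet, rat) mfps \<Rightarrow> rat" where
  "set_ones A B g = mfps_eval (\<lambda>v. if v \<in> XVar ` A \<union> YVar ` B then 1 else 0) g"

text \<open>
  A polynomial in \<open>i, j\<close> is an element of \<^typ>\<open>rat poly poly\<close>, where \<open>i\<close> is the indeterminate
  of the coefficient polynomials and \<open>j\<close> is the outer indeterminate.
\<close>

definition poly_i :: "rat poly poly" where "poly_i = [:[:0, 1:]:]"
definition poly_j :: "rat poly poly" where "poly_j = [:0, 1:]"

definition poly2 :: "rat poly poly \<Rightarrow> rat \<Rightarrow> rat \<Rightarrow> rat" where
  "poly2 P i j = poly (poly P [:j:]) i"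

definition is_ones_polynomial :: "(indet, rat) mfps \<Rightarrow> rat poly poly \<Rightarrow> bool" where
  "is_ones_polynomial g P \<longleftrightarrow>
     (\<forall>A B. finite A \<longrightarrow> finite B \<longrightarrow>
        set_ones A B g = poly2 P (of_nat (card A)) (of_nat (card B)))"

lemma is_ones_polynomial_unique:
  assumes "is_ones_polynomial g P" "is_ones_polynomial g Q"
  shows "P = Q"
proof -
  have inf: "infinite (range (of_nat :: nat \<Rightarrow> 'b :: semiring_char_0))"
    using infinite_UNIV_nat finite_imageD inj_of_nat by blast
  have eq: "poly2 P (of_nat a) (of_nat b) = poly2 Q (of_nat a) (of_nat b)" for a b
    using assms unfolding is_ones_polynomial_def
    by (metis card_lessThan finite_lessThan)
  have *: "p = q" if "\<And>a. poly p (of_nat a) = poly q (of_nat a)"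
    for p q :: "'b :: {idom, ring_char_0} poly"
  proof (rule ccontr)
    assume "p \<noteq> q"
    then have "finite {x. poly (p - q) x = 0}" by (intro poly_roots_finite) simp
    moreover have "range of_nat \<subseteq> {x. poly (p - q) x = 0}" using that by auto
    ultimately show False using inf finite_subset by blast
  qed
  show ?thesis
    by (intro *) (use eq in \<open>simp add: poly2_def of_nat_poly\<close>)
qed

definition ones_polynomial :: "(indet, rat) mfps \<Rightarrow> rat poly poly" where
  "ones_polynomial g = (THE P. is_ones_polynomial g P)"

lemma ones_polynomial_eqI: "is_ones_polynomial g P \<Longrightarrow> ones_polynomial g = P"
  unfolding ones_polynomial_def using is_ones_polynomial_unique by blast


section \<open>Path-cycle covers\<close>

definition path_cycle_covers :: "'a pair_pre_digraph \<Rightarrow> 'a rel set" where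
  "path_cycle_covers D = {S. S \<subseteq> parcs D \<and> inj_on fst S \<and> inj_on snd S}"

definition incident_arcs :: "'a rel \<Rightarrow> 'a set \<Rightarrow> 'a rel" where
  "incident_arcs S U = {e \<in> S. fst e \<in> U \<or> snd e \<in> U}"

text \<open>
  The arcs of the directed path and of the directed cycle through the vertices of a list, in this
  order (a single vertex gives no arc and a loop, respectively). The path or cycle is a component
  of the spanning subgraph with arc set \<open>S\<close> iff its arcs are precisely the arcs of \<open>S\<close> incident
  to its vertices.
\<close>

definition path_arcs :: "'a list \<Rightarrow> 'a rel" where
  "path_arcs vs = set (zip vs (tl vs))"

definition cycle_arcs :: "'a list \<Rightarrow> 'a rel" where
  "cycle_arcs vs = set (zip vs (rotate1 vs))"

definition path_blocks :: "'a pair_pre_digraph \<Rightarrow> 'a rel \<Rightarrow> 'a set set" where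
  "path_blocks D S = {set vs | vs. vs \<noteq> [] \<and> distinct vs \<and> set vs \<subseteq> pverts D \<and>
     incident_arcs S (set vs) = path_arcs vs}"

definition cycle_blocks :: "'a pair_pre_digraph \<Rightarrow> 'a rel \<Rightarrow> 'a set set" where
  "cycle_blocks D S = {set vs | vs. vs \<noteq> [] \<and> distinct vs \<and> set vs \<subseteq> pverts D \<and>
     incident_arcs S (set vs) = cycle_arcs vs}"

definition block_type :: "'a set set \<Rightarrow> nat multiset" where
  "block_type \<P> = image_mset card (mset_set \<P>)"


section \<open>The cover polynomial and the path-cycle symmetric function\<close>

definition falling_power :: "'a :: comm_ring_1 \<Rightarrow> nat \<Rightarrow> 'a" where
  "falling_power x k = (\<Prod>r<k. x - of_nat r)"

definition cover_polynomial :: "'a pair_pre_digraph \<Rightarrow> rat poly poly" where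
  "cover_polynomial D = (\<Sum>S\<in>path_cycle_covers D.
     falling_power poly_i (card (path_blocks D S)) * poly_j ^ card (cycle_blocks D S))"

definition path_cycle_symfun :: "'a pair_pre_digraph \<Rightarrow> (indet, rat) mfps" where
  "path_cycle_symfun D = (\<Sum>S\<in>path_cycle_covers D.
     aug_msym_x (block_type (path_blocks D S)) * power_sum_y (block_type (cycle_blocks D S)))"

end

theory Submission
  imports Defs "HOL-Combinatorics.Multiset_Permutations"
begin

text \<open>
  Both sides are sums over the path-cycle covers \<open>S\<close> of \<open>D\<close>, and they agree term by term. Setting
  the variables of \<open>x\<close> indexed by \<open>A\<close> and the variables of \<open>y\<close> indexed by \<open>B\<close> equal to \<open>1\<close> and all
  others to \<open>0\<close> is a ring homomorphism on those power series for which only finitely many terms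
  survive, so it can be computed factor by factor.

  A power sum of positive degree becomes \<open>card B\<close> (lemma \<open>psum_y_eval\<close>), hence \<open>p\<^bsub>\<sigma>(S)\<^esub>\<close> becomes
  \<open>card B\<close> to the power \<open>\<ell>(\<sigma>(S))\<close>, blocks being nonempty. A monomial symmetric function \<open>m\<^sub>\<lambda>\<close> becomes the number of
  monomials with exponents \<open>\<lambda>\<close> in the variables indexed by \<open>A\<close>. Such a monomial amounts to a choice
  of \<open>\<ell>(\<lambda>)\<close> variables together with an arrangement of the parts of \<open>\<lambda>\<close> on them; the number of
  arrangements is the multinomial coefficient \<open>\<ell>(\<lambda>)! / (r\<^sub>1! r\<^sub>2! \<dots>)\<close>, and the factor
  \<open>r\<^sub>1! r\<^sub>2! \<dots>\<close> of the augmented function turns the count into the falling power of \<open>card A\<close>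
  (lemmas \<open>card_monomials_of_type\<close> and \<open>aug_msym_x_eval\<close>).
\<close>

section \<open>Evaluation as a partial ring homomorphism\<close>

text \<open>
  \<^const>\<open>Sum_any\<close> is additive and multiplicative only on finite supports, so the finiteness of the
  sum is carried along with its value.
\<close>

definition mfps_has_eval :: "('v \<Rightarrow> 'a) \<Rightarrow> ('v, 'a :: comm_ring_1) mfps \<Rightarrow> 'a \<Rightarrow> bool" where
  "mfps_has_eval \<rho> f c \<longleftrightarrow>
     finite {M. mfps_coeff f M * (\<Prod>v\<in>#M. \<rho> v) \<noteq> 0} \<and> mfps_eval \<rho> f = c"

lemma mfps_has_evalI:
  assumes "finite X" "\<And>M. M \<notin> X \<Longrightarrow> mfps_coeff f M * (\<Prod>v\<in>#M. \<rho> v) = 0"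
    and "(\<Sum>M\<in>X. mfps_coeff f M * (\<Prod>v\<in>#M. \<rho> v)) = c"
  shows "mfps_has_eval \<rho> f c"
proof -
  have sub: "{M. mfps_coeff f M * (\<Prod>v\<in>#M. \<rho> v) \<noteq> 0} \<subseteq> X"
    using assms(2) by blast
  then have "mfps_eval \<rho> f = c"
    unfolding mfps_eval_def using assms(1,3) by (simp add: Sum_any.expand_superset)
  then show ?thesis
    unfolding mfps_has_eval_def using finite_subset[OF sub assms(1)] by blast
qed

lemma mfps_has_evalE:
  assumes "mfps_has_eval \<rho> f c"
  obtains X where "finite X" "\<forall>M. M \<notin> X \<longrightarrow> mfps_coeff f M * (\<Prod>v\<in>#M. \<rho> v) = 0"
    and "(\<Sum>M\<in>X. mfps_coeff f M * (\<Prod>v\<in>#M. \<rho> v)) = c"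
  using assms unfolding mfps_has_eval_def mfps_eval_def Sum_any.expand_set
  by (intro that[of "{M. mfps_coeff f M * (\<Prod>v\<in>#M. \<rho> v) \<noteq> 0}"]) auto

lemma mfps_has_eval_zero: "mfps_has_eval \<rho> 0 0"
  by (rule mfps_has_evalI[of "{}"]) (auto simp: zero_mfps.rep_eq)

lemma mfps_has_eval_one: "mfps_has_eval \<rho> 1 1"
  by (rule mfps_has_evalI[of "{{#}}"]) (auto simp: one_mfps.rep_eq)

lemma mfps_has_eval_add:
  assumes "mfps_has_eval \<rho> f c" "mfps_has_eval \<rho> g d"
  shows "mfps_has_eval \<rho> (f + g) (c + d)"
proof -
  let ?t = "\<lambda>f M. mfps_coeff f M * (\<Prod>v\<in>#M. \<rho> v)"
  obtain X where X: "finite X" "\<forall>M. M \<notin> X \<longrightarrow> ?t f M = 0" "sum (?t f) X = c"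
    using assms(1) by (rule mfps_has_evalE)
  obtain Y where Y: "finite Y" "\<forall>M. M \<notin> Y \<longrightarrow> ?t g M = 0" "sum (?t g) Y = d"
    using assms(2) by (rule mfps_has_evalE)
  have t: "?t (f + g) M = ?t f M + ?t g M" for M
    by (simp add: plus_mfps.rep_eq distrib_right)
  have "sum (?t f) (X \<union> Y) = c" "sum (?t g) (X \<union> Y) = d"
    using X Y by (auto intro: sum.mono_neutral_right[THEN trans])
  then show ?thesis
    using X Y by (intro mfps_has_evalI[of "X \<union> Y"]) (auto simp: t sum.distrib)
qed

lemma mfps_has_eval_mult:
  assumes "mfps_has_eval \<rho> f c" "mfps_has_eval \<rho> g d"
  shows "mfps_has_eval \<rho> (f * g) (c * d)"
proof -
  let ?t = "\<lambda>f M. mfps_coeff f M * (\<Prod>v\<in>#M. \<rho> v)"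
  obtain X where X: "finite X" "\<forall>M. M \<notin> X \<longrightarrow> ?t f M = 0" "sum (?t f) X = c"
    using assms(1) by (rule mfps_has_evalE)
  obtain Y where Y: "finite Y" "\<forall>M. M \<notin> Y \<longrightarrow> ?t g M = 0" "sum (?t g) Y = d"
    using assms(2) by (rule mfps_has_evalE)
  define Z where "Z = (\<lambda>p. fst p + snd p) ` (X \<times> Y)"
  have t: "?t (f * g) M = (\<Sum>p\<in>{p\<in>X \<times> Y. fst p + snd p = M}. ?t f (fst p) * ?t g (snd p))" for M
  proof -
    have "?t (f * g) M = (\<Sum>p | fst p + snd p = M. ?t f (fst p) * ?t g (snd p))"
      by (auto simp: times_mfps.rep_eq case_prod_unfold sum_distrib_right intro!: sum.cong)
    also have "\<dots> = (\<Sum>p\<in>{p\<in>X \<times> Y. fst p + snd p = M}. ?t f (fst p) * ?t g (snd p))"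
    proof (rule sum.mono_neutral_right)
      show "\<forall>p\<in>{p. fst p + snd p = M} - {p\<in>X \<times> Y. fst p + snd p = M}.
          ?t f (fst p) * ?t g (snd p) = 0"
      proof
        fix p assume "p \<in> {p. fst p + snd p = M} - {p\<in>X \<times> Y. fst p + snd p = M}"
        then have "fst p \<notin> X \<or> snd p \<notin> Y"
          by (cases p) auto
        then show "?t f (fst p) * ?t g (snd p) = 0"
          using X(2)[rule_format, of "fst p"] Y(2)[rule_format, of "snd p"] by (elim disjE) simp_all
      qed
    qed (use finite_mset_splits'[of M] in auto)
    finally show ?thesis .
  qed
  have "sum (?t (f * g)) Z = (\<Sum>p\<in>X \<times> Y. ?t f (fst p) * ?t g (snd p))"
    unfolding t using X(1) Y(1) by (intro sum.group) (auto simp: Z_def)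
  also have "\<dots> = c * d"
    by (simp only: X(3)[symmetric] Y(3)[symmetric] sum_product sum.cartesian_product case_prod_unfold)
  finally have "sum (?t (f * g)) Z = c * d" .
  moreover have "?t (f * g) M = 0" if "M \<notin> Z" for M
  proof -
    have "{p\<in>X \<times> Y. fst p + snd p = M} = {}"
      using that by (force simp: Z_def)
    then show ?thesis
      unfolding t by (simp only: sum.empty)
  qed
  moreover have "finite Z"
    using X(1) Y(1) by (simp add: Z_def)
  ultimately show ?thesis
    by (intro mfps_has_evalI[of Z])
qed

lemma mfps_has_eval_of_nat: "mfps_has_eval \<rho> (of_nat n) (of_nat n)"
  by (induction n) (auto intro: mfps_has_eval_zero mfps_has_eval_one mfps_has_eval_add)

lemma mfps_has_eval_sum:
  "(\<And>s. s \<in> T \<Longrightarrow> mfps_has_eval \<rho> (f s) (c s)) \<Longrightarrow> mfps_has_eval \<rho> (sum f T) (sum c T)"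
  by (induction T rule: infinite_finite_induct)
     (auto intro: mfps_has_eval_zero mfps_has_eval_add)

lemma mfps_has_eval_prod_mset:
  "(\<And>s. s \<in># T \<Longrightarrow> mfps_has_eval \<rho> (f s) (c s)) \<Longrightarrow>
     mfps_has_eval \<rho> (\<Prod>s\<in>#T. f s) (\<Prod>s\<in>#T. c s)"
  by (induction T) (auto intro: mfps_has_eval_one mfps_has_eval_mult)

text \<open>
  Under a zero-one substitution the value of a monomial says whether all its indeterminates were
  set to one, so a sum of distinct monomials is evaluated by counting.
\<close>

lemma mfps_has_eval_indicator:
  fixes f :: "('v, 'a :: comm_ring_1) mfps"
  assumes coeff: "\<And>M. mfps_coeff f M = (if M \<in> X then 1 else 0)"
    and fin: "finite {M \<in> X. set_mset M \<subseteq> V}"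
  shows "mfps_has_eval (\<lambda>v. if v \<in> V then 1 else 0) f (of_nat (card {M \<in> X. set_mset M \<subseteq> V}))"
proof -
  have "(\<Prod>v\<in>#M. if v \<in> V then 1 else (0 :: 'a)) = (if set_mset M \<subseteq> V then 1 else 0)"
    for M :: "'v multiset"
    by (induction M) auto
  then show ?thesis
    using fin by (intro mfps_has_evalI[of "{M \<in> X. set_mset M \<subseteq> V}"]) (auto simp: coeff)
qed

section \<open>Counting monomials with prescribed exponents\<close>

text \<open>
  Reading off the exponents along a fixed enumeration of \<open>S\<close> identifies the monomials with support
  \<open>S\<close> and exponents \<open>\<mu>\<close> with the arrangements of \<open>\<mu>\<close> in a row. An arrangement containing \<open>0\<close>
  would come from a monomial of smaller support.
\<close>

lemma bij_betw_exponents_permutations: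
  fixes xs :: "'v list"
  assumes xs: "distinct xs" "set xs = S" "length xs = size \<mu>" and \<mu>: "0 \<notin># \<mu>"
  shows "bij_betw (\<lambda>M. map (count M) xs)
    {M. set_mset M = S \<and> image_mset (count M) (mset_set S) = \<mu>} (permutations_of_multiset \<mu>)"
proof (rule bij_betw_imageI)
  have mset_xs: "mset xs = mset_set S"
    using xs by (metis mset_set_set)
  show "inj_on (\<lambda>M. map (count M) xs)
      {M. set_mset M = S \<and> image_mset (count M) (mset_set S) = \<mu>}"
  proof (rule inj_onI)
    fix M N
    assume "M \<in> {M. set_mset M = S \<and> image_mset (count M) (mset_set S) = \<mu>}"
      and "N \<in> {M. set_mset M = S \<and> image_mset (count M) (mset_set S) = \<mu>}"
      and eq: "map (count M) xs = map (count N) xs"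
    then have supp: "set_mset M = S" "set_mset N = S"
      by auto
    show "M = N"
    proof (rule multiset_eqI)
      fix v show "count M v = count N v"
        using eq supp xs(2) by (metis map_eq_conv not_in_iff)
    qed
  qed
  show "(\<lambda>M. map (count M) xs) ` {M. set_mset M = S \<and> image_mset (count M) (mset_set S) = \<mu>}
      = permutations_of_multiset \<mu>"
  proof (intro equalityI subsetI)
    fix ks assume "ks \<in> permutations_of_multiset \<mu>"
    then have ks: "mset ks = \<mu>"
      by (rule permutations_of_multisetD)
    then have len: "length xs = length ks"
      using xs(3) by auto
    \<comment> \<open>the exponent function that puts \<open>ks\<close> along \<open>xs\<close>\<close>
    define e where "e v = (case map_of (zip xs ks) v of None \<Rightarrow> 0 | Some k \<Rightarrow> k)" for v
    have e_nth: "e (xs ! i) = ks ! i" if "i < length xs" for i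
      using that len xs(1) by (simp add: e_def map_of_zip_nth)
    have e_out: "e v = 0" if "v \<notin> S" for v
      using that len xs(2) by (auto simp: e_def split: option.split dest!: map_of_SomeD set_zip_leftD)
    have e_in: "0 < e v" if "v \<in> S" for v
    proof -
      obtain i where i: "i < length xs" "v = xs ! i"
        using \<open>v \<in> S\<close> xs(2) by (metis in_set_conv_nth)
      then have "e v \<in># \<mu>"
        using len ks e_nth by (metis nth_mem_mset)
      then show ?thesis
        using \<mu> by (metis gr0I)
    qed
    define M where "M = Abs_multiset e"
    have supp_e: "{v. 0 < e v} = S"
      using e_out e_in by force
    then have count_M: "count M = e"
      unfolding M_def using xs(2) by (metis List.finite_set count_Abs_multiset)
    have map_e: "map e xs = ks"
      using len e_nth by (intro nth_equalityI) auto
    have "set_mset M = S"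
      using supp_e by (simp add: set_mset_def count_M)
    moreover have "image_mset (count M) (mset_set S) = \<mu>"
      unfolding mset_xs[symmetric] count_M using map_e ks by (metis mset_map)
    moreover have "ks = map (count M) xs"
      by (simp add: count_M map_e)
    ultimately show
      "ks \<in> (\<lambda>M. map (count M) xs) ` {M. set_mset M = S \<and> image_mset (count M) (mset_set S) = \<mu>}"
      by blast
  qed (auto simp: mset_xs[symmetric] intro!: permutations_of_multisetI)
qed

lemma card_monomials_with_support:
  assumes "finite S" "card S = size \<mu>" "0 \<notin># \<mu>"
  shows "card {M. set_mset M = S \<and> image_mset (count M) (mset_set S) = \<mu>} =
    card (permutations_of_multiset \<mu>)"
proof -
  obtain xs where "distinct xs" "set xs = S"
    using assms(1) finite_distinct_list by blast
  then show ?thesis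
    using assms distinct_card[of xs]
    by (intro bij_betw_same_card[OF bij_betw_exponents_permutations]) auto
qed

text \<open>
  The supports are the subsets of \<open>V\<close> of size \<open>\<ell>(\<mu>)\<close>, and each of them carries the same number of
  monomials.
\<close>

lemma monomials_of_type:
  fixes V :: "'v set"
  assumes "finite V" "0 \<notin># \<mu>"
  defines "X \<equiv> {M. set_mset M \<subseteq> V \<and> image_mset (count M) (mset_set (set_mset M)) = \<mu>}"
  shows finite_monomials_of_type: "finite X"
    and card_monomials_of_type:
      "(\<Prod>k\<in>set_mset \<mu>. fact (count \<mu> k)) * card X = (card V choose size \<mu>) * fact (size \<mu>)"
proof -
  define supports where "supports = {S. S \<subseteq> V \<and> card S = size \<mu>}"
  define fibre where "fibre S = {M. set_mset M = S \<and> image_mset (count M) (mset_set S) = \<mu>}" for S :: "'v set"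
  have fin: "finite supports"
    using assms(1) by (simp add: supports_def)
  have X: "X = (\<Union>S\<in>supports. fibre S)"
  proof -
    have "card (set_mset M) = size \<mu>"
      if "image_mset (count M) (mset_set (set_mset M)) = \<mu>" for M :: "'v multiset"
      using that by (metis size_image_mset size_mset_set)
    then show ?thesis
      by (auto simp: X_def supports_def fibre_def)
  qed
  have card_fibre: "card (fibre S) = card (permutations_of_multiset \<mu>)" if "S \<in> supports" for S
    using that assms(1,2) unfolding fibre_def supports_def
    by (intro card_monomials_with_support) (auto intro: finite_subset)
  have "permutations_of_multiset \<mu> \<noteq> {}"
    by (metis ex_mset empty_iff permutations_of_multisetI)
  then have "finite (fibre S)" if "S \<in> supports" for S
    using card_fibre[OF that] by (intro card_ge_0_finite) (simp add: card_gt_0_iff)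
  note fin_fibre = this
  show "finite X"
    unfolding X using fin fin_fibre by blast
  have "card X = (\<Sum>S\<in>supports. card (fibre S))"
    unfolding X using fin fin_fibre by (intro card_UN_disjoint) (auto simp: fibre_def)
  also have "\<dots> = (card V choose size \<mu>) * card (permutations_of_multiset \<mu>)"
    using assms(1) by (simp add: card_fibre supports_def n_subsets)
  finally show "(\<Prod>k\<in>set_mset \<mu>. fact (count \<mu> k)) * card X = (card V choose size \<mu>) * fact (size \<mu>)"
    using card_permutations_of_multiset_aux[of \<mu>] by (simp add: mult_ac)
qed

lemma falling_power_of_nat:
  "falling_power (of_nat n :: rat) k = of_nat ((n choose k) * fact k)"
  by (simp add: falling_power_def binomial_gbinomial gbinomial_mult_fact lessThan_atLeast0 mult.commute)

section \<open>Values of the symmetric functions\<close>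

text \<open>
  The factorials in the augmented function cancel the denominator of the multinomial coefficient,
  so only the number of parts of \<open>\<mu>\<close> matters.
\<close>

lemma aug_msym_x_eval:
  assumes "finite A" "0 \<notin># \<mu>"
  shows "mfps_has_eval (\<lambda>v. if v \<in> XVar ` A \<union> YVar ` B then 1 else 0)
    (aug_msym_x \<mu>) (falling_power (of_nat (card A)) (size \<mu>))"
proof -
  let ?X = "{M. set_mset M \<subseteq> range XVar \<and> image_mset (count M) (mset_set (set_mset M)) = \<mu>}"
  let ?Y = "{M. set_mset M \<subseteq> XVar ` A \<and> image_mset (count M) (mset_set (set_mset M)) = \<mu>}"
  have Y: "{M \<in> ?X. set_mset M \<subseteq> XVar ` A \<union> YVar ` B} = ?Y"
    by fast
  have fin: "finite (XVar ` A)"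
    using assms(1) by simp
  have card: "card (XVar ` A) = card A"
    by (intro card_image inj_onI) simp
  have "mfps_has_eval (\<lambda>v. if v \<in> XVar ` A \<union> YVar ` B then 1 else 0)
      (msym_x \<mu>) (of_nat (card ?Y))"
    unfolding Y[symmetric]
  proof (rule mfps_has_eval_indicator)
    show "mfps_coeff (msym_x \<mu>) M = (if M \<in> ?X then 1 else 0)" for M
      by (simp add: msym_x_def Abs_mfps_inverse)
    show "finite {M \<in> ?X. set_mset M \<subseteq> XVar ` A \<union> YVar ` B}"
      unfolding Y using fin assms(2) by (rule finite_monomials_of_type)
  qed
  from mfps_has_eval_mult[OF mfps_has_eval_of_nat[of _ "\<Prod>k\<in>set_mset \<mu>. fact (count \<mu> k)"] this]
  show ?thesis
    using card_monomials_of_type[OF fin assms(2)] card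
    by (simp only: aug_msym_x_def falling_power_of_nat flip: of_nat_mult)
qed

text \<open>
  The surviving monomials are the \<open>y\<^sub>k\<^sup>n\<close> with \<open>k \<in> B\<close>; in degree \<open>0\<close> they would all coincide.
\<close>

lemma psum_y_eval:
  assumes "finite B" "0 < n"
  shows "mfps_has_eval (\<lambda>v. if v \<in> XVar ` A \<union> YVar ` B then 1 else 0)
    (psum_y n) (of_nat (card B))"
proof -
  let ?X = "{M. \<exists>k. M = replicate_mset n (YVar k)}"
  have eq: "{M \<in> ?X. set_mset M \<subseteq> XVar ` A \<union> YVar ` B} = (\<lambda>k. replicate_mset n (YVar k)) ` B"
    using assms(2) by auto
  have "inj_on (\<lambda>k. replicate_mset n (YVar k)) B"
  proof (rule inj_onI)
    fix k l assume "replicate_mset n (YVar k) = replicate_mset n (YVar l)"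
    then have "set_mset (replicate_mset n (YVar k)) = set_mset (replicate_mset n (YVar l))"
      by simp
    then show "k = l"
      using assms(2) by simp
  qed
  then have card: "card {M \<in> ?X. set_mset M \<subseteq> XVar ` A \<union> YVar ` B} = card B"
    unfolding eq by (rule card_image)
  show ?thesis
    unfolding card[symmetric]
  proof (rule mfps_has_eval_indicator)
    show "mfps_coeff (psum_y n) M = (if M \<in> ?X then 1 else 0)" for M
      by (simp add: psum_y_def Abs_mfps_inverse)
    show "finite {M \<in> ?X. set_mset M \<subseteq> XVar ` A \<union> YVar ` B}"
      unfolding eq using assms(1) by simp
  qed
qed

lemma power_sum_y_eval:
  assumes "finite B" "0 \<notin># \<mu>"
  shows "mfps_has_eval (\<lambda>v. if v \<in> XVar ` A \<union> YVar ` B then 1 else 0)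
    (power_sum_y \<mu>) (of_nat (card B) ^ size \<mu>)"
proof -
  have "0 < n" if "n \<in># \<mu>" for n
    using that assms(2) by (cases n) auto
  then have "mfps_has_eval (\<lambda>v. if v \<in> XVar ` A \<union> YVar ` B then 1 else 0)
      (power_sum_y \<mu>) (\<Prod>n\<in>#\<mu>. of_nat (card B))"
    unfolding power_sum_y_def using assms(1) by (intro mfps_has_eval_prod_mset psum_y_eval)
  then show ?thesis
    by simp
qed

section \<open>Values of the cover polynomial\<close>

lemma size_block_type: "size (block_type P) = card P"
  by (simp add: block_type_def)

lemma zero_notin_block_type:
  assumes "\<And>U. U \<in> P \<Longrightarrow> finite U \<and> U \<noteq> {}"
  shows "0 \<notin># block_type P"
  using assms by (cases "finite P") (auto simp: block_type_def card_eq_0_iff)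

lemma zero_notin_path_block_type: "0 \<notin># block_type (path_blocks D S)"
  by (rule zero_notin_block_type) (auto simp: path_blocks_def)

lemma zero_notin_cycle_block_type: "0 \<notin># block_type (cycle_blocks D S)"
  by (rule zero_notin_block_type) (auto simp: cycle_blocks_def)

lemma poly2_sum: "poly2 (sum P T) i j = (\<Sum>s\<in>T. poly2 (P s) i j)"
  by (simp add: poly2_def poly_sum)

lemma poly2_mult: "poly2 (P * Q) i j = poly2 P i j * poly2 Q i j"
  by (simp add: poly2_def)

lemma poly2_falling_power_i: "poly2 (falling_power poly_i k) i j = falling_power i k"
  by (simp add: poly2_def falling_power_def poly_i_def poly_prod of_nat_poly)

lemma poly2_power_j: "poly2 (poly_j ^ k) i j = j ^ k"
  by (simp add: poly2_def poly_j_def)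

theorem proposition1:
  fixes D :: "'a pair_pre_digraph"
  assumes "pair_fin_digraph D"
  shows "is_ones_polynomial (path_cycle_symfun D) (cover_polynomial D) \<and>
    ones_polynomial (path_cycle_symfun D) = cover_polynomial D"
proof -
  have "set_ones A B (path_cycle_symfun D) =
      poly2 (cover_polynomial D) (of_nat (card A)) (of_nat (card B))"
    if "finite A" "finite B" for A B
  proof -
    have "mfps_has_eval (\<lambda>v. if v \<in> XVar ` A \<union> YVar ` B then 1 else 0) (path_cycle_symfun D)
        (\<Sum>S\<in>path_cycle_covers D. falling_power (of_nat (card A)) (card (path_blocks D S)) *
           of_nat (card B) ^ card (cycle_blocks D S))"
      unfolding path_cycle_symfun_def size_block_type[symmetric]
      using that zero_notin_path_block_type zero_notin_cycle_block_type
      by (intro mfps_has_eval_sum mfps_has_eval_mult aug_msym_x_eval power_sum_y_eval)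
    then show ?thesis
      by (simp add: mfps_has_eval_def set_ones_def cover_polynomial_def poly2_sum poly2_mult
          poly2_falling_power_i poly2_power_j)
  qed
  then have "is_ones_polynomial (path_cycle_symfun D) (cover_polynomial D)"
    unfolding is_ones_polynomial_def by blast
  then show ?thesis
    using ones_polynomial_eqI by blast
qed

end
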